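(* Let $\beta\in[0,1]$. For every polynomial $P\in S(\beta)$ of degree $4$ with real coefficients, we have $d(P,\beta)\le 1-\frac13\beta(1-\beta)$.
   Context: For $\beta\in[0,1]$, $S(\beta)$ is the set of polynomials of degree at least $2$ with complex coefficients, with all (complex) roots in the closed unit disk $\{z\in\mathbb{C}: |z|\le 1\}$, and with at least one root at $\beta$. For $P\in S(\beta)$, $d(P,\beta)$ is the distance between $\beta$ and the closest (complex) root of the derivative $P'$, i.e. $d(P,\beta)=\min\{|\zeta-\beta| : \zeta\in\mathbb{C},\ P'(\zeta)=0\}$. *)

theory Defs
  imports "HOL-Analysis.Analysis" "HOL-Computational_Algebra.Computational_Algebra"
begin

definition sendov_polys :: "real \<Rightarrow> complex poly set" where
  "sendov_polys \<beta> =
     {P. degree P \<ge> 2 \<and> (\<forall>z. poly P z = 0 \<longrightarrow> cmod z \<le> 1) \<and> poly P (complex_of_real \<beta>) = 0}"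

(* Min is unspecified on empty or infinite sets; for degree P \<ge> 2 the set below is
   finite and nonempty, see crit_dist_set. *)
definition crit_dist :: "complex poly \<Rightarrow> real \<Rightarrow> real" where
  "crit_dist P \<beta> = Min {cmod (\<zeta> - complex_of_real \<beta>) | \<zeta>. poly (pderiv P) \<zeta> = 0}"

lemma crit_dist_set:
  assumes "degree P \<ge> 2"
  shows "finite {cmod (\<zeta> - complex_of_real \<beta>) | \<zeta>. poly (pderiv P) \<zeta> = 0}"
    and "{cmod (\<zeta> - complex_of_real \<beta>) | \<zeta>. poly (pderiv P) \<zeta> = 0} \<noteq> {}"
proof -
  have deg: "degree (pderiv P) > 0"
    using assms by (simp add: degree_pderiv)
  then have "pderiv P \<noteq> 0"
    by auto
  then have "finite {\<zeta>. poly (pderiv P) \<zeta> = 0}"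
    by (rule poly_roots_finite)
  then show "finite {cmod (\<zeta> - complex_of_real \<beta>) | \<zeta>. poly (pderiv P) \<zeta> = 0}"
    by simp
  have "\<not> constant (poly (pderiv P))"
    using deg by (simp add: constant_degree)
  then show "{cmod (\<zeta> - complex_of_real \<beta>) | \<zeta>. poly (pderiv P) \<zeta> = 0} \<noteq> {}"
    using fundamental_theorem_of_algebra by auto
qed

end

theory Submission
  imports Defs
begin

text \<open>
  Write \<open>D = 1 - \<beta> (1 - \<beta>) / 3\<close> and suppose that every critical point \<open>x\<^sub>j\<close> of \<open>P\<close> has distance more
  than \<open>D\<close> from \<open>\<beta>\<close>. With the other three roots \<open>z\<^sub>i\<close> of \<open>P\<close>, put \<open>g\<^sub>i = \<beta> - z\<^sub>i\<close> and \<open>h\<^sub>j = \<beta> - x\<^sub>j\<close>.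
  Comparing Taylor coefficients of \<open>P'\<close> at \<open>\<beta>\<close> turns the elementary symmetric functions of the \<open>h\<^sub>j\<close>
  into multiples of those of the \<open>g\<^sub>i\<close> (lemma \<open>symmetric_functions_of_shifted_critical_points\<close>).
  Since all \<open>|h\<^sub>j| > D\<close>, three inequalities result (lemma \<open>conj_triple_outside_disk\<close>):
  \<open>h\<^sub>1 h\<^sub>2 h\<^sub>3\<close> is large, \<open>\<Sum> 1 / h\<^sub>j\<close> is smaller than \<open>3 / D\<close>, and \<open>P'\<close>, having real coefficients and no zero
  between \<open>\<beta> - D\<close> and \<open>\<beta>\<close>, has the same sign at both of these points. It remains to see that roots in
  the closed unit disk cannot satisfy all three.

  The large product rules out real roots \<open>z\<^sub>i \<ge> \<beta>\<close>. If all \<open>z\<^sub>i\<close> are real, each \<open>1 / g\<^sub>i\<close> is therefore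
  at least \<open>1 / (1 + \<beta>)\<close>, which is too much for the bound on the sum, as \<open>D \<ge> (1 + \<beta>) / 2\<close>
  (lemma \<open>no_real_triple\<close>).

  Otherwise the roots are one real number and a conjugate pair, so that \<open>g\<^sub>1 = a\<close> is real and
  \<open>g\<^sub>2, g\<^sub>3 = c \<plusminus> i s\<close>. In terms of \<open>Y = D / a\<close>, \<open>r = D c / (c\<^sup>2 + s\<^sup>2)\<close> and \<open>S = D\<^sup>2 / (c\<^sup>2 + s\<^sup>2)\<close>,
  membership of the pair in the unit disk is a linear lower bound on a combination of \<open>r\<close> and \<open>S\<close>, and
  the three inequalities are linear in \<open>r\<close> and \<open>S\<close> for fixed \<open>Y\<close>. Eliminating \<open>r\<close> and \<open>S\<close> leaves a
  concave quadratic in \<open>Y\<close> that ought to be negative but is nonnegative at both ends of its range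
  (lemma \<open>normalized_contradiction\<close>). There is no room to spare at \<open>\<beta> = 1\<close>: the polynomial
  \<open>z\<^sup>4 - 1\<close> attains \<open>d(P, 1) = 1\<close>, and correspondingly the value at the left end has a double zero
  in \<open>1 - \<beta>\<close>.
\<close>

section \<open>Roots of cubics with real coefficients\<close>

lemma poly_cnj_of_real_coeffs:
  fixes P :: "complex poly"
  assumes "\<forall>i. coeff P i \<in> \<real>"
  shows "poly P (cnj z) = cnj (poly P z)"
  using assms by (simp add: poly_altdef Reals_cnj_iff)

lemma linear_factor_of_positive_degree:
  assumes "degree (P::complex poly) = Suc n"
  obtains z Q where "P = [:- z, 1:] * Q" "degree Q = n"
proof -
  have "\<not> constant (poly P)" using assms by (simp add: constant_degree)
  then obtain z where "poly P z = 0" using fundamental_theorem_of_algebra by blast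
  then obtain Q where Q: "P = [:- z, 1:] * Q" by (auto simp: poly_eq_0_iff_dvd elim: dvdE)
  have "Q \<noteq> 0" using Q assms by auto
  then have "degree P = 1 + degree Q" unfolding Q by (subst degree_mult_eq) auto
  then show ?thesis using that Q assms by simp
qed

text \<open>
  Conjugation permutes the roots, so a nonreal root brings its conjugate along. That the third root
  is then real (rather than a repetition of a nonreal one) follows from the sum of the roots, which
  is a quotient of real coefficients.
\<close>
lemma real_cubic_roots:
  fixes Q :: "complex poly"
  assumes deg: "degree Q = 3" and real: "\<forall>i. coeff Q i \<in> \<real>"
  obtains x y z where "Q = smult (coeff Q 3) ([:- x, 1:] * [:- y, 1:] * [:- z, 1:])"
    "x \<in> \<real> \<and> y \<in> \<real> \<and> z \<in> \<real> \<or> x \<in> \<real> \<and> z = cnj y"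
proof -
  define l where "l = coeff Q 3"
  have l0: "l \<noteq> 0" unfolding l_def using deg by (metis leading_coeff_0_iff degree_0 zero_neq_numeral)
  obtain x Q1 where 1: "Q = [:- x, 1:] * Q1" "degree Q1 = Suc (Suc 0)"
    using linear_factor_of_positive_degree[of Q "Suc (Suc 0)"] deg by (auto simp: numeral_3_eq_3)
  obtain y Q2 where 2: "Q1 = [:- y, 1:] * Q2" "degree Q2 = Suc 0"
    using linear_factor_of_positive_degree[OF 1(2)] by auto
  obtain z Q3 where 3: "Q2 = [:- z, 1:] * Q3" "degree Q3 = 0"
    using linear_factor_of_positive_degree[OF 2(2)] by auto
  obtain k where k: "Q3 = [:k:]" using degree_0_id[OF 3(2)] by metis
  have Qk: "Q = smult k ([:- x, 1:] * [:- y, 1:] * [:- z, 1:])"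
    unfolding 1 2 3 k by (simp add: algebra_simps)
  have "l = k" unfolding l_def Qk by (simp add: numeral_3_eq_3)
  with Qk have Q: "Q = smult l ([:- x, 1:] * [:- y, 1:] * [:- z, 1:])" by simp
  have split: "\<exists>x y z. Q = smult l ([:- x, 1:] * [:- y, 1:] * [:- z, 1:]) \<and> x \<in> \<real> \<and> z = cnj y"
    if f: "Q = smult l ([:- a, 1:] * [:- b, 1:] * [:- c, 1:])" and b: "b \<notin> \<real>" for a b c
  proof -
    have "coeff Q 2 = - l * (a + b + c)"
      unfolding f by (simp add: numeral_2_eq_2 algebra_simps)
    then have sum: "a + b + c \<in> \<real>"
      using real l0 by (smt (verit, del_insts) Reals_divide Reals_minus l_def nonzero_mult_div_cancel_left neg_equal_0_iff_equal)
    have "poly Q (cnj b) = 0" unfolding poly_cnj_of_real_coeffs[OF real] unfolding f poly_smult poly_mult by simp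
    then have "cnj b = a \<or> cnj b = b \<or> cnj b = c" using l0 unfolding f poly_smult poly_mult by auto
    then consider "cnj b = a" | "cnj b = c" using b by (auto simp: Reals_cnj_iff)
    then show ?thesis
    proof cases
      case 1
      have "c \<in> \<real>" using sum 1 by (auto simp: complex_is_Real_iff)
      moreover have "Q = smult l ([:- c, 1:] * [:- b, 1:] * [:- a, 1:])" unfolding f by (simp only: ac_simps)
      ultimately show ?thesis using 1 by metis
    next
      case 2
      have "a \<in> \<real>" using sum 2 by (auto simp: complex_is_Real_iff)
      then show ?thesis using f 2 by metis
    qed
  qed
  consider "x \<in> \<real> \<and> y \<in> \<real> \<and> z \<in> \<real>" | "x \<notin> \<real>" | "y \<notin> \<real>" | "z \<notin> \<real>" by blast
  then show ?thesis
  proof cases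
    case 1
    then show ?thesis using that[of x y z] Q unfolding l_def by blast
  next
    case 2
    have "Q = smult l ([:- y, 1:] * [:- x, 1:] * [:- z, 1:])" unfolding Q by (simp only: ac_simps)
    from split[OF this 2, unfolded l_def] show ?thesis using that by blast
  next
    case 3
    from split[OF Q 3, unfolded l_def] show ?thesis using that by blast
  next
    case 4
    have "Q = smult l ([:- x, 1:] * [:- z, 1:] * [:- y, 1:])" unfolding Q by (simp only: ac_simps)
    from split[OF this 4, unfolded l_def] show ?thesis using that by blast
  qed
qed

section \<open>Inequalities from critical points far from \<open>\<beta>\<close>\<close>

text \<open>
  The last inequality is \<open>u v w (u - D) (v - D) (w - D) > 0\<close>. It holds because \<open>t (t - D) > 0\<close> for a
  real \<open>t\<close> with \<open>|t| > D\<close>, while a conjugate pair contributes a product of two squared moduli. The one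
  before it is \<open>|1/u + 1/v + 1/w| < 3 / D\<close> with denominators cleared.
\<close>
lemma conj_triple_outside_disk:
  fixes D :: real and u v w :: complex
  assumes conj: "u \<in> \<real> \<and> v \<in> \<real> \<and> w \<in> \<real> \<or> u \<in> \<real> \<and> w = cnj v"
    and D: "D > 0" and out: "cmod u > D" "cmod v > D" "cmod w > D"
  obtains s1 s2 s3 :: real where
    "of_real s1 = u + v + w" "of_real s2 = u * v + v * w + w * u" "of_real s3 = u * v * w"
    "\<bar>s3\<bar> > D ^ 3" "D * \<bar>s2\<bar> < 3 * \<bar>s3\<bar>" "s3 * (s3 - D * s2 + D\<^sup>2 * s1 - D ^ 3) > 0"
proof -
  have ex: "\<exists>s1 s2 s3 :: real. of_real s1 = u + v + w \<and> of_real s2 = u * v + v * w + w * u \<and>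
     of_real s3 = u * v * w \<and> s3 * (s3 - D * s2 + D\<^sup>2 * s1 - D ^ 3) > 0"
  proof -
    have pos: "a * (a - D) > 0" if "\<bar>a\<bar> > D" for a :: real
      using that D by (cases "a > 0") (auto intro: mult_neg_neg)
    obtain a where a: "u = of_real a" using conj by (auto elim: Reals_cases)
    have pa: "a * (a - D) > 0" using out(1) pos a by simp
    from conj show ?thesis
    proof (elim disjE conjE)
      assume "v \<in> \<real>" "w \<in> \<real>"
      then obtain b c where bc: "v = of_real b" "w = of_real c" by (auto elim!: Reals_cases)
      have "(a * (a - D)) * (b * (b - D)) * (c * (c - D)) > 0"
        using pa pos[of b] pos[of c] out bc by simp
      also have "(a * (a - D)) * (b * (b - D)) * (c * (c - D)) =
         (a * b * c) * (a * b * c - D * (a * b + b * c + c * a) + D\<^sup>2 * (a + b + c) - D ^ 3)"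
        by algebra
      finally show ?thesis unfolding a bc
        by (intro exI[of _ "a + b + c"] exI[of _ "a * b + b * c + c * a"] exI[of _ "a * b * c"]) simp
    next
      assume w: "w = cnj v"
      obtain p q where v: "v = Complex p q" by (cases v)
      have N: "D\<^sup>2 < p\<^sup>2 + q\<^sup>2" using out(2) D unfolding v
        by (simp add: complex_norm real_less_rsqrt) (metis real_less_rsqrt real_sqrt_less_iff real_sqrt_unique less_eq_real_def)
      have "(p - D)\<^sup>2 + q\<^sup>2 > 0"
      proof (rule ccontr)
        assume "\<not> ?thesis"
        then have "p = D \<and> q = 0" by (metis not_sum_power2_lt_zero sum_power2_gt_zero_iff diff_eq_eq add_0 eq_iff_diff_eq_0)
        with N show False by simp
      qed
      then have "(a * (a - D)) * ((p\<^sup>2 + q\<^sup>2) * ((p - D)\<^sup>2 + q\<^sup>2)) > 0"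
        using pa N by (smt (verit, best) zero_le_power2 mult_pos_pos)
      also have "(a * (a - D)) * ((p\<^sup>2 + q\<^sup>2) * ((p - D)\<^sup>2 + q\<^sup>2)) =
         (a * (p\<^sup>2 + q\<^sup>2)) * (a * (p\<^sup>2 + q\<^sup>2) - D * (2 * a * p + (p\<^sup>2 + q\<^sup>2)) + D\<^sup>2 * (a + 2 * p) - D ^ 3)"
        by algebra
      finally show ?thesis unfolding a w v
        by (intro exI[of _ "a + 2 * p"] exI[of _ "2 * a * p + (p\<^sup>2 + q\<^sup>2)"] exI[of _ "a * (p\<^sup>2 + q\<^sup>2)"])
          (simp add: complex_eq_iff power2_eq_square algebra_simps)
    qed
  qed
  then obtain s1 s2 s3 :: real where s: "of_real s1 = u + v + w" "of_real s2 = u * v + v * w + w * u"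
    "of_real s3 = u * v * w" "s3 * (s3 - D * s2 + D\<^sup>2 * s1 - D ^ 3) > 0" by blast
  define A B C where "A = cmod u" "B = cmod v" "C = cmod w"
  note abc = out[folded A_B_C_def]
  have s3: "\<bar>s3\<bar> = A * B * C" using s(3) by (metis A_B_C_def norm_mult norm_of_real real_norm_def)
  have "\<bar>s2\<bar> \<le> A * B + B * C + C * A"
  proof -
    have "\<bar>s2\<bar> = cmod (u * v + v * w + w * u)" using s(2) by (metis norm_of_real)
    also have "\<dots> \<le> cmod (u * v) + cmod (v * w) + cmod (w * u)"
      by (intro norm_triangle_mono norm_triangle_ineq order_refl)
    finally show ?thesis by (simp add: A_B_C_def norm_mult)
  qed
  then have "D * \<bar>s2\<bar> \<le> D * (A * B + B * C + C * A)" using D by simp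
  also have "\<dots> = D * (A * B) + D * (B * C) + D * (C * A)" by algebra
  also have "\<dots> < C * (A * B) + A * (B * C) + B * (C * A)"
    using abc D by (intro add_strict_mono mult_strict_right_mono) auto
  finally have 2: "D * \<bar>s2\<bar> < 3 * \<bar>s3\<bar>" unfolding s3 by (simp add: algebra_simps)
  have "D * D * D < A * B * C" using abc D by (intro mult_strict_mono) auto
  then have "\<bar>s3\<bar> > D ^ 3" unfolding s3 by (simp add: power3_eq_cube)
  then show ?thesis using that s 2 by blast
qed

text \<open>
  Substituting \<open>b + t\<close> turns the assumption into
  \<open>4 (t + h\<^sub>1) (t + h\<^sub>2) (t + h\<^sub>3) = d/dt (t (t + g\<^sub>1) (t + g\<^sub>2) (t + g\<^sub>3))\<close>, and the claims compare
  coefficients of powers of \<open>t\<close>.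
\<close>
lemma symmetric_functions_of_shifted_critical_points:
  fixes b z1 z2 z3 x1 x2 x3 k :: complex
  assumes k: "k \<noteq> 0"
    and eq: "pderiv (smult k ([:- b, 1:] * ([:- z1, 1:] * [:- z2, 1:] * [:- z3, 1:]))) =
      smult (4 * k) ([:- x1, 1:] * [:- x2, 1:] * [:- x3, 1:])"
    and g: "g1 = b - z1" "g2 = b - z2" "g3 = b - z3"
    and h: "h1 = b - x1" "h2 = b - x2" "h3 = b - x3"
  shows "4 * (h1 + h2 + h3) = 3 * (g1 + g2 + g3)"
    "2 * (h1 * h2 + h2 * h3 + h3 * h1) = g1 * g2 + g2 * g3 + g3 * g1"
    "4 * (h1 * h2 * h3) = g1 * g2 * g3"
proof -
  define A B C where "A = 4 * (h1 + h2 + h3) - 3 * (g1 + g2 + g3)"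
    and "B = 4 * (h1 * h2 + h2 * h3 + h3 * h1) - 2 * (g1 * g2 + g2 * g3 + g3 * g1)"
    and "C = 4 * (h1 * h2 * h3) - g1 * g2 * g3"
  have zero: "A * t^2 + B * t + C = 0" for t
  proof -
    have "k * (A * t^2 + B * t + C) =
      poly (smult (4 * k) ([:- x1, 1:] * [:- x2, 1:] * [:- x3, 1:])) (b + t) -
      poly (pderiv (smult k ([:- b, 1:] * ([:- z1, 1:] * [:- z2, 1:] * [:- z3, 1:])))) (b + t)"
      unfolding pderiv_smult pderiv_mult pderiv_pCons poly_smult poly_mult poly_add A_def B_def C_def g h
      by (simp add: pderiv_pCons) algebra
    then show ?thesis using k eq by simp
  qed
  have C: "C = 0" using zero[of 0] by simp
  moreover have AB: "A + B + C = 0" using zero[of 1] by simp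
  moreover have "A - B + C = 0" using zero[of "-1"] by simp
  ultimately have "2 * A = 0" by algebra
  then have A: "A = 0" by simp
  with AB C have "B = 0" by simp
  note this A C
  then show "4 * (h1 + h2 + h3) = 3 * (g1 + g2 + g3)"
    "2 * (h1 * h2 + h2 * h3 + h3 * h1) = g1 * g2 + g2 * g3 + g3 * g1"
    "4 * (h1 * h2 * h3) = g1 * g2 * g3" unfolding A_def B_def C_def by (simp, algebra, simp)
qed

section \<open>Real roots\<close>

definition radius :: "real \<Rightarrow> real" where "radius \<beta> = 1 - 1 / 3 * \<beta> * (1 - \<beta>)"

lemma radius_bounds:
  assumes "0 \<le> \<beta>" "\<beta> \<le> 1"
  shows "radius \<beta> \<ge> 11 / 12" "radius \<beta> \<ge> (1 + \<beta>) / 2"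
proof -
  have "radius \<beta> - 11 / 12 = (\<beta> - 1 / 2)\<^sup>2 / 3" unfolding radius_def by (simp add: field_simps power2_eq_square)
  then show "radius \<beta> \<ge> 11 / 12" by (smt (verit) zero_le_power2 divide_nonneg_nonneg)
  have "radius \<beta> - (1 + \<beta>) / 2 = (1 - \<beta>) * (3 - 2 * \<beta>) / 6" unfolding radius_def by (simp add: field_simps)
  moreover have "(1 - \<beta>) * (3 - 2 * \<beta>) \<ge> 0" using assms by (intro mult_nonneg_nonneg) auto
  ultimately show "radius \<beta> \<ge> (1 + \<beta>) / 2" by linarith
qed

text \<open>
  A real root \<open>\<beta> - a\<close> with \<open>a \<le> 0\<close> lies in \<open>[\<beta>, 1]\<close>, hence so close to \<open>\<beta>\<close> that the product of the
  three distances cannot exceed \<open>(1 - \<beta>) (1 + \<beta>)\<^sup>2\<close>, whose maximum over \<open>[0, 1]\<close> is \<open>32 / 27\<close>. The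
  number \<open>N\<close> stands for the product of the other two differences.
\<close>
lemma real_root_left:
  assumes b: "0 \<le> \<beta>" "\<beta> \<le> 1" and a: "\<bar>\<beta> - a\<bar> \<le> 1" and N: "\<bar>N\<bar> \<le> (1 + \<beta>)\<^sup>2"
    and big: "\<bar>a * N\<bar> > 4 * radius \<beta> ^ 3"
  shows "a > 0"
proof (rule ccontr)
  assume "\<not> a > 0"
  then have "\<bar>a\<bar> \<le> 1 - \<beta>" using a by linarith
  then have "\<bar>a * N\<bar> \<le> (1 - \<beta>) * (1 + \<beta>)\<^sup>2" unfolding abs_mult using N by (intro mult_mono) auto
  \<comment> \<open>The square is the double contact at the maximum, which is attained at \<open>\<beta> = 1 / 3\<close>.\<close>
  also have "\<dots> = 32 / 27 - (\<beta> - 1 / 3)\<^sup>2 * (\<beta> + 5 / 3)" by algebra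
  also have "\<dots> \<le> 32 / 27" using b by simp
  also have "\<dots> < 4 * (11 / 12) ^ 3" by (simp add: power3_eq_cube)
  also have "\<dots> \<le> 4 * radius \<beta> ^ 3" using radius_bounds(1)[OF b] by (intro mult_left_mono power_mono) auto
  finally show False using big by simp
qed

lemma no_real_triple:
  assumes b: "0 \<le> \<beta>" "\<beta> \<le> 1"
    and x: "\<bar>\<beta> - x\<bar> \<le> 1" and y: "\<bar>\<beta> - y\<bar> \<le> 1" and z: "\<bar>\<beta> - z\<bar> \<le> 1"
    and big: "\<bar>x * y * z\<bar> > 4 * radius \<beta> ^ 3"
    and sum: "2 * radius \<beta> * \<bar>x * y + y * z + z * x\<bar> < 3 * \<bar>x * y * z\<bar>"
  shows False
proof -
  have ax: "\<bar>x\<bar> \<le> 1 + \<beta>" "\<bar>y\<bar> \<le> 1 + \<beta>" "\<bar>z\<bar> \<le> 1 + \<beta>" using b x y z by linarith+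
  have pr: "\<bar>s * t\<bar> \<le> (1 + \<beta>)\<^sup>2" if "\<bar>s\<bar> \<le> 1 + \<beta>" "\<bar>t\<bar> \<le> 1 + \<beta>" for s t
    unfolding abs_mult power2_eq_square using that by (intro mult_mono) auto
  have p: "x > 0" "y > 0" "z > 0"
    using real_root_left[OF b x pr[OF ax(2,3)]] real_root_left[OF b y pr[OF ax(1,3)]] real_root_left[OF b z pr[OF ax(1,2)]] big
    by (simp_all add: ac_simps)
  have "3 * (x * y * z) = z * (x * y) + x * (y * z) + y * (z * x)" by algebra
  also have "\<dots> \<le> (1 + \<beta>) * (x * y) + (1 + \<beta>) * (y * z) + (1 + \<beta>) * (z * x)"
    using ax p by (intro add_mono mult_right_mono) auto
  also have "\<dots> = (1 + \<beta>) * (x * y + y * z + z * x)" by algebra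
  also have "\<dots> \<le> 2 * radius \<beta> * (x * y + y * z + z * x)"
    using radius_bounds(2)[OF b] p by (intro mult_right_mono) auto
  finally show False using sum p by (simp add: abs_of_pos add_pos_pos)
qed


section \<open>One real root and a conjugate pair\<close>

text \<open>
  The heart of the proof, in the scaled reciprocals \<open>Y\<close>, \<open>r\<close>, \<open>S\<close> described at the beginning. The
  assumption \<open>S(2)\<close> is the large product, \<open>sum\<close> the bound on the sum of reciprocals, \<open>val\<close> the sign
  comparison at \<open>\<beta> - D\<close>, and \<open>disk\<close> says that the pair lies in the unit disk. For \<open>Y \<ge> 2 / 3\<close> the
  real root alone uses up so much of \<open>sum\<close> that \<open>disk\<close> fails. For \<open>Y < 2 / 3\<close> the coefficient
  \<open>4 - 6 Y\<close> of \<open>r\<close> in \<open>val\<close> is positive, so \<open>r\<close> may be replaced by its lower bound from \<open>disk\<close>; after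
  that \<open>S\<close> has a nonpositive coefficient and may be replaced by its upper bound \<open>1 / (4 Y)\<close>.
\<close>
lemma normalized_contradiction:
  fixes \<beta> D Y r S :: real
  assumes b: "0 \<le> \<beta>" "\<beta> \<le> 1" and D_def: "D = radius \<beta>"
    and Y: "D \<le> (1 + \<beta>) * Y" and S: "S > 0" "4 * (Y * S) < 1"
    and sum: "2 * Y + 4 * r < 3"
    and val: "2 * Y + 4 * r - 6 * (Y * r) - 3 * S + 4 * (Y * S) < 1"
    and disk: "D\<^sup>2 \<le> 2 * \<beta> * D * r + (1 - \<beta>\<^sup>2) * S"
  shows False
proof -
  have D: "D \<ge> 11 / 12" "D \<ge> (1 + \<beta>) / 2" using radius_bounds[OF b] D_def by auto
  have K0: "1 - \<beta>\<^sup>2 \<ge> 0" using b by (simp add: power_le_one)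
  show False
  proof (cases "Y \<ge> 2 / 3")
    case True
    have "(2 / 3) * S \<le> Y * S" using True S by (intro mult_right_mono) auto
    then have "S \<le> 3 / 8" using S by linarith
    then have 1: "(1 - \<beta>\<^sup>2) * S \<le> (1 - \<beta>\<^sup>2) * (3 / 8)" using K0 by (rule mult_left_mono)
    have "r \<le> 5 / 12" using sum True by linarith
    then have 2: "2 * \<beta> * D * r \<le> 2 * \<beta> * D * (5 / 12)" using b D by (intro mult_left_mono) auto
    \<comment> \<open>\<open>D\<^sup>2 - 5/6 \<beta> D\<close> increases with \<open>D\<close> in the relevant range, so \<open>D\<close> may be replaced by \<open>11 / 12\<close>.\<close>
    have "(D - 11 / 12) * (D + 11 / 12 - 5 / 6 * \<beta>) \<ge> 0" using D b by (intro mult_nonneg_nonneg) auto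
    then have "D\<^sup>2 - 5 / 6 * \<beta> * D \<ge> (11 / 12)\<^sup>2 - 5 / 6 * \<beta> * (11 / 12)"
      by (simp add: algebra_simps power2_eq_square)
    moreover have "(\<beta> - 1)\<^sup>2 \<ge> 0" by simp
    then have "\<beta>\<^sup>2 \<ge> 2 * \<beta> - 1" by (simp add: power2_eq_square algebra_simps)
    moreover have "(1 - \<beta>\<^sup>2) * (3 / 8) = 3 / 8 - 3 / 8 * \<beta>\<^sup>2" by simp
    moreover have "(11 / 12)\<^sup>2 = (121 / 144 :: real)" by (simp add: power2_eq_square)
    ultimately show False using 1 2 disk b by linarith
  next
    case False
    define e where "e = 1 - \<beta>"
    have be: "\<beta> = 1 - e" by (simp add: e_def)
    have De: "D = 1 - 1 / 3 * (1 - e) * e" unfolding D_def radius_def be by simp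
    have "(1 + \<beta>) * Y < (1 + \<beta>) * (2 / 3)" using False b by (intro mult_strict_left_mono) auto
    then have small: "D < (1 + \<beta>) * (2 / 3)" using Y by linarith
    \<comment> \<open>\<open>small\<close> amounts to \<open>\<beta>\<^sup>2 - 3 \<beta> + 1 < 0\<close>, whose smaller root is just above \<open>19 / 50\<close>.\<close>
    have e: "0 \<le> e" "e < 31 / 50"
    proof -
      show "0 \<le> e" using b e_def by simp
      show "e < 31 / 50"
      proof (rule ccontr)
        assume "\<not> ?thesis"
        then have "(\<beta> - 19 / 50) * (\<beta> - 131 / 50) \<ge> 0" using b unfolding e_def by (intro mult_nonpos_nonpos) auto
        moreover have "(\<beta> - 19 / 50) * (\<beta> - 131 / 50) = \<beta>\<^sup>2 - 3 * \<beta> + 2489 / 2500"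
          by (simp add: field_simps power2_eq_square)
        ultimately have "\<beta>\<^sup>2 - 3 * \<beta> + 1 > 0" by linarith
        moreover have "3 * (D - (1 + \<beta>) * (2 / 3)) = \<beta>\<^sup>2 - 3 * \<beta> + 1"
          unfolding D_def radius_def by (simp add: field_simps power2_eq_square)
        ultimately have "3 * (D - (1 + \<beta>) * (2 / 3)) > 0" by simp
        then show False using small by simp
      qed
    qed
    define M K where "M = 2 * \<beta> * D" and "K = 1 - \<beta>\<^sup>2"
    have M: "M > 0" using e D unfolding M_def e_def by (intro mult_pos_pos) auto
    \<comment> \<open>\<open>G Y\<close> is what remains of \<open>val\<close>, multiplied by \<open>4 Y M\<close>, after both replacements;
      \<open>- B\<close> is the coefficient of \<open>S\<close> after the first one.\<close>
    define G where "G y = (8 * M - 24 * D\<^sup>2) * y\<^sup>2 + (16 * D\<^sup>2 + 6 * K) * y - 4 * K - 3 * M" for y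
    define B where "B = (4 - 6 * Y) * K + M * (3 - 4 * Y)"
    have "(1 + \<beta>) * Y > 0" using Y D by linarith
    then have Y0: "Y > 0" using b by (simp add: zero_less_mult_iff)
    have neg: "G Y < 0"
    proof -
      have "(4 - 6 * Y) * D\<^sup>2 \<le> (4 - 6 * Y) * (M * r + K * S)"
        using disk False unfolding M_def K_def by (intro mult_left_mono) auto
      moreover have "M * (2 * Y - 1 + r * (4 - 6 * Y) + S * (4 * Y - 3)) < 0"
        using val M by (intro mult_pos_neg) (auto simp: algebra_simps)
      moreover have "M * (2 * Y - 1 + r * (4 - 6 * Y) + S * (4 * Y - 3)) =
         M * (2 * Y - 1) + (4 - 6 * Y) * (M * r + K * S) - S * B"
        unfolding B_def by algebra
      ultimately have "M * (2 * Y - 1) + (4 - 6 * Y) * D\<^sup>2 - S * B < 0" by linarith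
      then have "4 * Y * (M * (2 * Y - 1) + (4 - 6 * Y) * D\<^sup>2 - S * B) < 0" using Y0 by (simp add: mult_pos_neg)
      moreover have "B \<ge> 0" unfolding B_def using False M K0 by (simp add: K_def)
      then have "4 * (Y * S) * B \<le> 1 * B" using S(2) by (intro mult_right_mono) auto
      moreover have "4 * Y * (M * (2 * Y - 1) + (4 - 6 * Y) * D\<^sup>2 - S * B) = G Y + B - 4 * (Y * S) * B"
        unfolding G_def B_def by algebra
      ultimately show ?thesis by linarith
    qed
    define y0 where "y0 = D / (1 + \<beta>)"
    have y0: "y0 \<le> Y" "y0 < 2 / 3" using Y small b unfolding y0_def by (simp_all add: field_simps)
    have right: "G (2 / 3) \<ge> 0"
    proof -
      have "G (2 / 3) = 5 / 9 * M" unfolding G_def by (simp add: algebra_simps power2_eq_square)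
      then show ?thesis using M by simp
    qed
    have left: "G y0 \<ge> 0"
    proof -
      \<comment> \<open>As a polynomial in \<open>e = 1 - \<beta>\<close>, \<open>(1 + \<beta>)\<^sup>2 G(y0)\<close> has the factor \<open>e\<^sup>2\<close>; the cofactor decreases
        and is still positive at \<open>31 / 50\<close>.\<close>
      have "e^2 \<le> (31/50)^2" "e^3 \<le> (31/50)^3" "e^6 \<le> (31/50)^6" using e by (auto intro!: power_mono)
      then have "270 - 294 * e - 30 * e^2 - 100 * e^3 - 8 * e^6 \<ge> 0" using e
        by (simp add: eval_nat_numeral)
      then have "e\<^sup>2 * (270 - 294 * e - 30 * e^2 - 100 * e^3 - 8 * e^6) / 27 \<ge> 0" by simp
      also have "e\<^sup>2 * (270 - 294 * e - 30 * e^2 - 100 * e^3 - 8 * e^6) / 27 =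
        (8 * M - 24 * D\<^sup>2) * D\<^sup>2 + (16 * D\<^sup>2 + 6 * K) * D * (1 + \<beta>) - (4 * K + 3 * M) * (1 + \<beta>)\<^sup>2"
        unfolding M_def K_def De be by (simp add: field_simps eval_nat_numeral)
      also have "\<dots> = (1 + \<beta>)\<^sup>2 * G y0"
      proof -
        have "D = (1 + \<beta>) * y0" using b unfolding y0_def by simp
        then have "(8 * M - 24 * D\<^sup>2) * D\<^sup>2 = (8 * M - 24 * D\<^sup>2) * ((1 + \<beta>) * y0)\<^sup>2"
          "(16 * D\<^sup>2 + 6 * K) * D * (1 + \<beta>) = (16 * D\<^sup>2 + 6 * K) * ((1 + \<beta>) * y0) * (1 + \<beta>)" by simp_all
        then show ?thesis unfolding G_def by algebra
      qed
      finally show ?thesis using b by (simp add: zero_le_mult_iff)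
    qed
    have "M \<le> 2 * D * D" using D b unfolding M_def by simp
    then have "M \<le> 2 * D\<^sup>2" by (simp add: power2_eq_square)
    moreover have "D\<^sup>2 \<ge> 0" by simp
    ultimately have q: "8 * M - 24 * D\<^sup>2 \<le> 0" by linarith
    \<comment> \<open>Concavity of \<open>G\<close>, in the form of linear interpolation with its exact error term.\<close>
    have "(2 / 3 - y0) * G Y = (2 / 3 - Y) * G y0 + (Y - y0) * G (2 / 3)
       - (8 * M - 24 * D\<^sup>2) * ((2 / 3 - y0) * (Y - y0) * (2 / 3 - Y))"
      unfolding G_def by (simp add: field_simps power2_eq_square)
    moreover have "(2 / 3 - Y) * G y0 \<ge> 0" "(Y - y0) * G (2 / 3) \<ge> 0"
      using left right y0 False by simp_all
    moreover have "(8 * M - 24 * D\<^sup>2) * ((2 / 3 - y0) * (Y - y0) * (2 / 3 - Y)) \<le> 0"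
      using q y0 False by (intro mult_nonpos_nonneg mult_nonneg_nonneg) auto
    moreover have "(2 / 3 - y0) * G Y < 0" using neg y0 by (intro mult_pos_neg) auto
    ultimately show False by linarith
  qed
qed

text \<open>
  The assumptions are the three inequalities of \<open>conj_triple_outside_disk\<close>, expressed through the
  differences \<open>a\<close> and \<open>c \<plusminus> i s\<close>. Dividing by \<open>a N\<close>, which is positive, passes to reciprocals.
\<close>
lemma no_conj_triple:
  assumes b: "0 \<le> \<beta>" "\<beta> \<le> 1" and D_def: "D = radius \<beta>"
    and a: "\<bar>\<beta> - a\<bar> \<le> 1" and c: "(\<beta> - c)\<^sup>2 + s\<^sup>2 \<le> 1"
    and N: "N = c\<^sup>2 + s\<^sup>2"
    and big: "\<bar>a * N\<bar> > 4 * D ^ 3"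
    and sum: "2 * D * \<bar>2 * a * c + N\<bar> < 3 * \<bar>a * N\<bar>"
    and val: "a * N * (a * N - 2 * D * (2 * a * c + N) + 3 * D\<^sup>2 * (a + 2 * c) - 4 * D ^ 3) > 0"
  shows False
proof -
  have D: "D \<ge> 11 / 12" using radius_bounds[OF b] D_def by auto
  have Nle: "N \<le> 1 - \<beta>\<^sup>2 + 2 * \<beta> * c" using c unfolding N by (simp add: power2_eq_square algebra_simps)
  have "(\<beta> - c)\<^sup>2 \<le> 1" using c by (smt (verit) zero_le_power2)
  then have "\<bar>\<beta> - c\<bar> \<le> 1" by (simp add: abs_square_le_1)
  then have "\<beta> * c \<le> \<beta> * (1 + \<beta>)" using b by (intro mult_left_mono) auto
  then have "\<bar>N\<bar> \<le> (1 + \<beta>)\<^sup>2" using Nle unfolding N by (simp add: power2_eq_square algebra_simps)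
  then have a0: "a > 0" using real_root_left[OF b a _ ] big D_def by blast
  have "N \<noteq> 0" using big D by auto
  then have N0: "N > 0" unfolding N by (metis sum_power2_ge_zero less_eq_real_def)
  have p: "a * N > 0" using a0 N0 by simp
  define Y r S where "Y = D / a" and "r = D * c / N" and "S = D\<^sup>2 / N"
  show False
  proof (rule normalized_contradiction[OF b D_def])
    show "D \<le> (1 + \<beta>) * Y"
    proof -
      have "D * a \<le> D * (1 + \<beta>)" using a D by (intro mult_left_mono) auto
      then show ?thesis using a0 unfolding Y_def by (simp add: field_simps)
    qed
    show "S > 0" using D N0 unfolding S_def by simp
    have "4 * (Y * S) = 4 * D ^ 3 / (a * N)" unfolding Y_def S_def by (simp add: power2_eq_square power3_eq_cube)
    then show "4 * (Y * S) < 1" using big p by simp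
    have "2 * D * (2 * a * c + N) \<le> 2 * D * \<bar>2 * a * c + N\<bar>" using D by (intro mult_left_mono) auto
    then have "2 * D * (2 * a * c + N) < 3 * (a * N)" using sum p by linarith
    then have "2 * D * (2 * a * c + N) / (a * N) < 3" using p by (simp add: pos_divide_less_eq)
    moreover have "2 * D * (2 * a * c + N) / (a * N) = 2 * Y + 4 * r"
      unfolding Y_def r_def using a0 N0 by (simp add: field_simps)
    ultimately show "2 * Y + 4 * r < 3" by simp
    have "0 < a * N - 2 * D * (2 * a * c + N) + 3 * D\<^sup>2 * (a + 2 * c) - 4 * D ^ 3"
      using val p by (simp add: zero_less_mult_iff)
    then have "0 < (a * N - 2 * D * (2 * a * c + N) + 3 * D\<^sup>2 * (a + 2 * c) - 4 * D ^ 3) / (a * N)"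
      using p by simp
    also have "\<dots> = 1 - (2 * Y + 4 * r - 6 * (Y * r) - 3 * S + 4 * (Y * S))"
      unfolding Y_def r_def S_def using a0 N0 by (simp add: field_simps power2_eq_square power3_eq_cube)
    finally show "2 * Y + 4 * r - 6 * (Y * r) - 3 * S + 4 * (Y * S) < 1" by simp
    have "D\<^sup>2 * 1 \<le> D\<^sup>2 * ((1 - \<beta>\<^sup>2 + 2 * \<beta> * c) / N)"
      using Nle N0 by (intro mult_left_mono) auto
    also have "\<dots> = 2 * \<beta> * D * r + (1 - \<beta>\<^sup>2) * S"
      unfolding r_def S_def using N0 by (simp add: field_simps power2_eq_square)
    finally show "D\<^sup>2 \<le> 2 * \<beta> * D * r + (1 - \<beta>\<^sup>2) * S" by simp
  qed
qed

section \<open>The bound for real quartics\<close>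

theorem theorem5:
  fixes \<beta> :: real and P :: "complex poly"
  assumes "0 \<le> \<beta>" and "\<beta> \<le> 1"
    and "P \<in> sendov_polys \<beta>"
    and "degree P = 4"
    and "\<forall>i. coeff P i \<in> \<real>"
  shows "crit_dist P \<beta> \<le> 1 - 1 / 3 * \<beta> * (1 - \<beta>)"
proof (rule ccontr)
  assume contra: "\<not> ?thesis"
  define D b where "D = radius \<beta>" and "b = complex_of_real \<beta>"
  have D: "D \<ge> 11 / 12" using radius_bounds[OF assms(1,2)] D_def by auto
  have roots: "\<And>z. poly P z = 0 \<Longrightarrow> cmod z \<le> 1" and Pb: "poly P b = 0" and deg: "2 \<le> degree P"
    using assms(3) by (auto simp: sendov_polys_def b_def)
  have crit: "cmod (b - x) > D" if "poly (pderiv P) x = 0" for x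
  proof -
    have "crit_dist P \<beta> \<le> cmod (x - complex_of_real \<beta>)"
      unfolding crit_dist_def using that crit_dist_set[OF deg] by (intro Min_le) auto
    then show ?thesis using contra unfolding D_def radius_def b_def by (simp add: norm_minus_commute)
  qed
  obtain Q where PQ: "P = [:- b, 1:] * Q" using Pb by (auto simp: poly_eq_0_iff_dvd elim: dvdE)
  have degQ: "degree Q = 3"
  proof -
    have "Q \<noteq> 0" using PQ assms(4) by auto
    then have "degree P = 1 + degree Q" unfolding PQ by (subst degree_mult_eq) auto
    then show ?thesis using assms(4) by simp
  qed
  have cP: "coeff P (Suc i) = coeff Q i - b * coeff Q (Suc i)" for i
    unfolding PQ by simp
  have bR: "b \<in> \<real>" by (simp add: b_def)
  \<comment> \<open>Synthetic division by \<open>z - \<beta>\<close> keeps coefficients real, from the leading one downwards.\<close>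
  have realQ: "coeff Q i \<in> \<real>" for i
  proof (cases "i \<le> 4")
    case True
    then show ?thesis
    proof (induction rule: inc_induct)
      case base then show ?case using degQ by (simp add: coeff_eq_0)
    next
      case (step n)
      have "coeff Q n = coeff P (Suc n) + b * coeff Q (Suc n)" using cP[of n] by simp
      then show ?case using step assms(5) bR by simp
    qed
  next
    case False
    then show ?thesis using degQ by (simp add: coeff_eq_0)
  qed
  define k where "k = coeff Q 3"
  have k0: "k \<noteq> 0" unfolding k_def using degQ by (metis leading_coeff_0_iff degree_0 zero_neq_numeral)
  obtain z1 z2 z3 where Q: "Q = smult k ([:- z1, 1:] * [:- z2, 1:] * [:- z3, 1:])"
    and zc: "z1 \<in> \<real> \<and> z2 \<in> \<real> \<and> z3 \<in> \<real> \<or> z1 \<in> \<real> \<and> z3 = cnj z2"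
    using real_cubic_roots[OF degQ] realQ unfolding k_def by metis
  have P: "P = smult k ([:- b, 1:] * ([:- z1, 1:] * [:- z2, 1:] * [:- z3, 1:]))"
    unfolding PQ Q by (simp only: mult_smult_right)
  have z: "cmod z1 \<le> 1" "cmod z2 \<le> 1" "cmod z3 \<le> 1"
    by (rule roots, unfold P poly_smult poly_mult, simp)+
  have degP': "degree (pderiv P) = 3" using assms(4) by (simp add: degree_pderiv)
  have realP': "\<forall>i. coeff (pderiv P) i \<in> \<real>" using assms(5) by (simp add: coeff_pderiv)
  have k4: "coeff (pderiv P) 3 = 4 * k"
    using cP[of 3] degQ by (simp add: coeff_pderiv k_def coeff_eq_0)
  obtain x1 x2 x3 where P': "pderiv P = smult (4 * k) ([:- x1, 1:] * [:- x2, 1:] * [:- x3, 1:])"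
    and xc: "x1 \<in> \<real> \<and> x2 \<in> \<real> \<and> x3 \<in> \<real> \<or> x1 \<in> \<real> \<and> x3 = cnj x2"
    using real_cubic_roots[OF degP' realP'] unfolding k4 by metis
  have x: "cmod (b - x1) > D" "cmod (b - x2) > D" "cmod (b - x3) > D"
    by (rule crit, unfold P' poly_smult poly_mult, simp)+
  have hc: "b - x1 \<in> \<real> \<and> b - x2 \<in> \<real> \<and> b - x3 \<in> \<real> \<or> b - x1 \<in> \<real> \<and> b - x3 = cnj (b - x2)"
    using xc bR by (auto simp: b_def)
  have "D > 0" using D by simp
  from conj_triple_outside_disk[OF hc this x]
  obtain s1 s2 s3 where s: "of_real s1 = (b - x1) + (b - x2) + (b - x3)"
    "of_real s2 = (b - x1) * (b - x2) + (b - x2) * (b - x3) + (b - x3) * (b - x1)"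
    "of_real s3 = (b - x1) * (b - x2) * (b - x3)"
    and b3: "\<bar>s3\<bar> > D ^ 3" and b2: "D * \<bar>s2\<bar> < 3 * \<bar>s3\<bar>"
    and b1: "s3 * (s3 - D * s2 + D\<^sup>2 * s1 - D ^ 3) > 0" by metis
  note sym = symmetric_functions_of_shifted_critical_points[OF k0 P'[unfolded P] refl refl refl refl refl refl, folded s]
  from zc show False
  proof (elim disjE conjE)
    assume "z1 \<in> \<real>" "z2 \<in> \<real>" "z3 \<in> \<real>"
    then obtain t1 t2 t3 where t: "z1 = of_real t1" "z2 = of_real t2" "z3 = of_real t3"
      by (auto elim!: Reals_cases)
    define a1 a2 a3 where "a1 = \<beta> - t1" and "a2 = \<beta> - t2" and "a3 = \<beta> - t3"
    have g: "b - z1 = of_real a1" "b - z2 = of_real a2" "b - z3 = of_real a3"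
      unfolding a1_def a2_def a3_def b_def t by simp_all
    have "complex_of_real (2 * s2) = of_real (a1 * a2 + a2 * a3 + a3 * a1)" using sym(2) unfolding g by simp
    then have s2: "2 * s2 = a1 * a2 + a2 * a3 + a3 * a1" unfolding of_real_eq_iff .
    have "complex_of_real (4 * s3) = of_real (a1 * a2 * a3)" using sym(3) unfolding g by simp
    then have s3: "4 * s3 = a1 * a2 * a3" unfolding of_real_eq_iff .
    show False
    proof (rule no_real_triple[OF assms(1,2)])
      show "\<bar>\<beta> - a1\<bar> \<le> 1" "\<bar>\<beta> - a2\<bar> \<le> 1" "\<bar>\<beta> - a3\<bar> \<le> 1"
        using z unfolding t a1_def a2_def a3_def by simp_all
      show "4 * radius \<beta> ^ 3 < \<bar>a1 * a2 * a3\<bar>" using b3 unfolding s3[symmetric] D_def by simp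
      show "2 * radius \<beta> * \<bar>a1 * a2 + a2 * a3 + a3 * a1\<bar> < 3 * \<bar>a1 * a2 * a3\<bar>"
        using b2 unfolding s3[symmetric] s2[symmetric] D_def by (simp add: abs_mult mult.commute)
    qed
  next
    assume "z1 \<in> \<real>" and z3: "z3 = cnj z2"
    then obtain t1 where t: "z1 = of_real t1" by (auto elim: Reals_cases)
    define a c s N where "a = \<beta> - t1" and "c = \<beta> - Re z2" and "s = - Im z2" and "N = c\<^sup>2 + s\<^sup>2"
    have g: "b - z1 = of_real a" "b - z2 = Complex c s" "b - z3 = Complex c (- s)"
      unfolding a_def c_def s_def b_def t z3 by (simp_all add: complex_eq_iff)
    have s1: "4 * s1 = 3 * (a + 2 * c)" using arg_cong[OF sym(1), of Re] unfolding g by simp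
    have s2: "2 * s2 = 2 * a * c + N" using arg_cong[OF sym(2), of Re] unfolding g N_def by (simp add: power2_eq_square)
    have s3: "4 * s3 = a * N" using arg_cong[OF sym(3), of Re] unfolding g N_def
      by (simp add: power2_eq_square algebra_simps)
    show False
    proof (rule no_conj_triple[OF assms(1,2) D_def _ _ N_def])
      show "\<bar>\<beta> - a\<bar> \<le> 1" using z unfolding t a_def by simp
      show "(\<beta> - c)\<^sup>2 + s\<^sup>2 \<le> 1" using z(2) unfolding c_def s_def by (simp add: cmod_def)
      show "4 * D ^ 3 < \<bar>a * N\<bar>" using b3 unfolding s3[symmetric] by simp
      show "2 * D * \<bar>2 * a * c + N\<bar> < 3 * \<bar>a * N\<bar>"
        using b2 unfolding s3[symmetric] s2[symmetric] by (simp add: abs_mult mult.commute)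
      have "a * N * (a * N - 2 * D * (2 * a * c + N) + 3 * D\<^sup>2 * (a + 2 * c) - 4 * D ^ 3) =
        16 * (s3 * (s3 - D * s2 + D\<^sup>2 * s1 - D ^ 3))"
        using s1 s2 s3 by algebra
      then show "a * N * (a * N - 2 * D * (2 * a * c + N) + 3 * D\<^sup>2 * (a + 2 * c) - 4 * D ^ 3) > 0"
        using b1 by simp
    qed
  qed
qed

end
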